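(* Let $n\ge1$. For 2-cells $S,T\colon b_n\Longrightarrow e_n\colon 0\to n$ in the $n$-category $\mathcal O_n$, the following conditions are equivalent: (i) $\ell_S\le\ell_T$; (ii) $r_S\le r_T$; (iii) there exists a 3-cell $S\to T$ in $\mathcal O_n$; (iv) for all $x\in S$ and $y\in T$, if $x_1=y_1$ then $x_0\le y_0$; (v) for all $x\in S$ and $y\in T$, if $x_1=y_1$ then $x_2\le y_2$; (vi) for all $x\in S$ and $y\in T$, if $x_1=y_1$ then $x_0\le y_0$ and $x_2\le y_2$.
   Context: The oriental $\mathcal O_n$ is the free $n$-category on the $n$-simplex with vertices $0,1,\dots,n$; $b_n\colon0\to n$ is the 1-cell consisting of the single edge $(0\,n)$, and $e_n\colon0\to n$ is the path of edges $(01),(12),\dots,(n-1\;n)$. **2-cells.** A triangle is a triple $x=(x_0x_1x_2)$ of elements of $\{0,\dots,n\}$ with $x_0<x_1<x_2$; its left leg is $(x_0x_1)$, right leg $(x_1x_2)$, long leg $(x_0x_2)$. For a set $S$ of triangles, $S^-$ is the set of long legs of its members and $S^+$ the set of all left and right legs of its members. A 2-cell $S\colon b_n\Rightarrow e_n$ is (for $n\ge2$) a set $S$ of triangles such that: (a) if two triangles in $S$ share the same left leg, or the same right leg, or the same long leg, then they are equal; (b) for $x,y\in S$, if $x_1=y_0$ then $x_2\ne y_1$; (c) $S^-\smallsetminus S^+=\{(0\,n)\}$; (d) $S^+\smallsetminus S^-=\{(01),\dots,(n-1\;n)\}$. For $n=1$ the only such 2-cell is the empty set. For such $S$ the map $x\mapsto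 x_1$ (middle vertex) is a bijection $S\to\{1,\dots,n-1\}$. **The functions $\ell_S,r_S$.** For $\mathbf n=\{0,\dots,n-1\}$, $\ell_S,r_S\colon\mathbf n\to\mathbf n$ are defined by: for $1\le i\le n-1$, the unique triangle of $S$ with middle vertex $i$ is $(\ell_S(i-1),\,i,\,r_S(i)+1)$; and $\ell_S(n-1)=n-1$, $r_S(0)=0$. Functions $\mathbf n\to\mathbf n$ are ordered pointwise. **3-cells.** The 3-cells of $\mathcal O_n$ between 2-cells $b_n\Rightarrow e_n$ are generated under composition (together with identities) by the indecomposable ones: there is an indecomposable 3-cell $S\to T$ given by $x=(x_0x_1x_2x_3)$, with $x_0<x_1<x_2<x_3$ in $\{0,\dots,n\}$, precisely when $S$ contains $(x_0x_1x_2)$ and $(x_0x_2x_3)$ and $T=(S\smallsetminus\{(x_0x_1x_2),(x_0x_2x_3)\})\cup\{(x_0x_1x_3),(x_1x_2x_3)\}$. So a 3-cell $S\to T$ exists iff $T$ can be obtained from $S$ by a finite (possibly empty) sequence of such moves. *)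

theory Defs
  imports Main
begin

text \<open>
  A triple \<open>(a, b, c)\<close> stands for the triangle with vertices \<open>a, b, c\<close>, and a pair for an edge.
\<close>

type_synonym edge = "nat \<times> nat"
type_synonym triangle = "nat \<times> nat \<times> nat"

definition triangles :: "nat \<Rightarrow> triangle set" where
  "triangles n = {(a, b, c). a < b \<and> b < c \<and> c \<le> n}"

fun left_leg :: "triangle \<Rightarrow> edge" where
  "left_leg (a, b, c) = (a, b)"

fun right_leg :: "triangle \<Rightarrow> edge" where
  "right_leg (a, b, c) = (b, c)"

fun long_leg :: "triangle \<Rightarrow> edge" where
  "long_leg (a, b, c) = (a, c)"

fun middle :: "triangle \<Rightarrow> nat" where
  "middle (a, b, c) = b"

definition neg_faces :: "triangle set \<Rightarrow> edge set" where
  "neg_faces S = long_leg ` S"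

definition pos_faces :: "triangle set \<Rightarrow> edge set" where
  "pos_faces S = left_leg ` S \<union> right_leg ` S"

text \<open>
  \<open>two_cell n S\<close>: \<open>S\<close> is a 2-cell from the edge \<open>(0, n)\<close> to the path \<open>(0, 1), \<dots>, (n-1, n)\<close> in the
  \<open>n\<close>-th oriental.  For \<open>n = 1\<close> both are the same edge and the only such 2-cell is the identity,
  represented by the empty set; it does not satisfy the two boundary equations below, hence the
  separate clause.
\<close>

definition two_cell :: "nat \<Rightarrow> triangle set \<Rightarrow> bool" where
  "two_cell n S \<longleftrightarrow>
     n = 1 \<and> S = {} \<or>
     n \<ge> 2 \<and> S \<subseteq> triangles n \<and>
     inj_on left_leg S \<and> inj_on right_leg S \<and> inj_on long_leg S \<and>
     (\<forall>(x0, x1, x2)\<in>S. \<forall>(y0, y1, y2)\<in>S. x1 = y0 \<longrightarrow> x2 \<noteq> y1) \<and>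
     neg_faces S - pos_faces S = {(0, n)} \<and>
     pos_faces S - neg_faces S = {(i, i + 1) | i. i < n}"

text \<open>In a 2-cell there is exactly one triangle with middle vertex \<open>i\<close> for each \<open>1 \<le> i \<le> n - 1\<close>.\<close>

definition triangle_at :: "triangle set \<Rightarrow> nat \<Rightarrow> triangle" where
  "triangle_at S i = (THE x. x \<in> S \<and> middle x = i)"

text \<open>
  \<open>ell n S\<close> and \<open>arr n S\<close> are the functions \<open>\<ell>\<^sub>S\<close> and \<open>r\<^sub>S\<close> on \<open>{0, \<dots>, n - 1}\<close>, determined by
  \<open>triangle_at S i = (ell n S (i - 1), i, arr n S i + 1)\<close> for \<open>1 \<le> i \<le> n - 1\<close>;
  their values at arguments \<open>\<ge> n\<close> are meaningless.
\<close>

definition ell :: "nat \<Rightarrow> triangle set \<Rightarrow> nat \<Rightarrow> nat" where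
  "ell n S j = (if j = n - 1 then n - 1 else (case triangle_at S (j + 1) of (a, b, c) \<Rightarrow> a))"

definition arr :: "nat \<Rightarrow> triangle set \<Rightarrow> nat \<Rightarrow> nat" where
  "arr n S j = (if j = 0 then 0 else (case triangle_at S j of (a, b, c) \<Rightarrow> c - 1))"

definition pointwise_le :: "nat \<Rightarrow> (nat \<Rightarrow> nat) \<Rightarrow> (nat \<Rightarrow> nat) \<Rightarrow> bool" where
  "pointwise_le n f g \<longleftrightarrow> (\<forall>j<n. f j \<le> g j)"

text \<open>
  The indecomposable 3-cells between 2-cells from \<open>(0, n)\<close> to \<open>(0, 1), \<dots>, (n-1, n)\<close>, and the
  existence of an arbitrary 3-cell, that is, of a finite, possibly empty (identity), composite of
  indecomposable ones.
\<close>

definition indecomposable_3cell :: "nat \<Rightarrow> triangle set \<Rightarrow> triangle set \<Rightarrow> bool" where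
  "indecomposable_3cell n S T \<longleftrightarrow>
     two_cell n S \<and> two_cell n T \<and>
     (\<exists>x0 x1 x2 x3. x0 < x1 \<and> x1 < x2 \<and> x2 < x3 \<and> x3 \<le> n \<and>
        (x0, x1, x2) \<in> S \<and> (x0, x2, x3) \<in> S \<and>
        T = (S - {(x0, x1, x2), (x0, x2, x3)}) \<union> {(x0, x1, x3), (x1, x2, x3)})"

definition exists_3cell :: "nat \<Rightarrow> triangle set \<Rightarrow> triangle set \<Rightarrow> bool" where
  "exists_3cell n = (indecomposable_3cell n)\<^sup>*\<^sup>*"

end

theory Submission
  imports Defs
begin

text \<open>
  A 2-cell is a triangulation of a polygon, that is, a binary tree of triangles, and an
  indecomposable 3-cell is a tree rotation.  A rotation increases both outer vertices of the
  triangle at each middle vertex.  Conversely, suppose that condition (iv) holds for \<open>S\<close> and \<open>T\<close>,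
  and let \<open>(0, m, n)\<close> be the root of \<open>T\<close>.  Then the triangle of \<open>S\<close> at \<open>m\<close> starts at \<open>0\<close>, so it
  lies on the left spine of \<open>S\<close>, and rotations carry it to the root; the triangles moved on the
  way get first vertex \<open>m\<close>, so that (iv) is preserved, and one continues with the two subtrees.
  Finally (v) implies (iv), because the first vertices of a triangulation are determined by the
  last ones: triangles do not cross.
\<close>

section \<open>Triangulated polygons as binary trees, and rotations\<close>

text \<open>The polygon has vertices \<open>a\<close>, ..., \<open>b\<close>, and the root is the
  triangle on the base edge \<open>(a, b)\<close>. The empty set triangulates a single edge, which
  absorbs the special case \<open>n = 1\<close> of \<open>two_cell\<close>.\<close>

inductive triangulation :: "nat \<Rightarrow> nat \<Rightarrow> triangle set \<Rightarrow> bool" where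
  edge: "triangulation a (Suc a) {}"
| glue: "triangulation a m L \<Longrightarrow> triangulation m b R \<Longrightarrow>
    triangulation a b (insert (a, m, b) (L \<union> R))"

definition unit_edges :: "nat \<Rightarrow> nat \<Rightarrow> edge set" where
  "unit_edges a b = {(i, i + 1) | i. a \<le> i \<and> i < b}"

text \<open>The indecomposable 3-cells over an arbitrary interval of vertices, so that inductions
  can descend into subtrees.\<close>

definition rotation :: "nat \<Rightarrow> nat \<Rightarrow> triangle set \<Rightarrow> triangle set \<Rightarrow> bool" where
  "rotation a b S T \<longleftrightarrow> triangulation a b S \<and> triangulation a b T \<and>
     (\<exists>x0 x1 x2 x3. (x0, x1, x2) \<in> S \<and> (x0, x2, x3) \<in> S \<and>
        T = (S - {(x0, x1, x2), (x0, x2, x3)}) \<union> {(x0, x1, x3), (x1, x2, x3)})"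

section \<open>Ranges, middle vertices and nesting\<close>

lemma triangulation_less: "triangulation a b S \<Longrightarrow> a < b"
  by (induction rule: triangulation.induct) auto

lemma triangulation_range:
  assumes "triangulation a b S" and "(x0, x1, x2) \<in> S"
  shows "a \<le> x0 \<and> x0 < x1 \<and> x1 < x2 \<and> x2 \<le> b"
  using assms
proof (induction arbitrary: x0 x1 x2 rule: triangulation.induct)
  case (glue a m L b R)
  then show ?case
    using triangulation_less[OF glue.hyps(1)] triangulation_less[OF glue.hyps(2)] by fastforce
qed simp

text \<open>The root \<open>(a, m, b)\<close> separates the middle vertices: those of the left
  subtree are below \<open>m\<close>, those of the right one above. As both legs contain the middle
  vertex, injectivity of \<open>left_leg\<close> and \<open>right_leg\<close> follows.\<close>

lemma triangulation_middle_unique: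
  assumes "triangulation a b S" and "(x0, i, x2) \<in> S" and "(y0, i, y2) \<in> S"
  shows "x0 = y0 \<and> x2 = y2"
  using assms
proof (induction rule: triangulation.induct)
  case (glue a m L b R)
  note less = triangulation_less[OF glue.hyps(1)] triangulation_less[OF glue.hyps(2)]
    and L = triangulation_range[OF glue.hyps(1)] and R = triangulation_range[OF glue.hyps(2)]
  \<comment> \<open>Each triangle is the root or lies in one of the subtrees. Two in the same
    subtree fall under the induction hypothesis; the ranges settle the other cases.\<close>
  from glue.prems less show ?case
    by (elim insertE UnE) (blast dest: glue.IH | force dest!: L R)+
qed simp

lemma triangulation_middle_exists:
  assumes "triangulation a b S" and "a < i" and "i < b"
  shows "\<exists>x0 x2. (x0, i, x2) \<in> S"
  using assms
proof (induction rule: triangulation.induct)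
  case (glue a m L b R)
  then show ?case
    by (cases i m rule: linorder_cases) auto
qed simp

text \<open>Triangles of a triangulation do not cross.\<close>

lemma triangulation_left_nested:
  assumes "triangulation a b S" and "(x0, x1, x2) \<in> S" and "(y0, y1, y2) \<in> S"
    and "x0 < y1" and "y1 < x1"
  shows "y2 \<le> x1"
  using assms
proof (induction rule: triangulation.induct)
  case (glue a m L b R)
  note less = triangulation_less[OF glue.hyps(1)] triangulation_less[OF glue.hyps(2)]
    and L = triangulation_range[OF glue.hyps(1)] and R = triangulation_range[OF glue.hyps(2)]
  from glue.prems less show ?case
    by (elim insertE UnE) (blast dest: glue.IH | force dest!: L R)+
qed simp

text \<open>Otherwise \<open>y0 < x0 < y2 < x2\<close>, and the two long legs would cross.\<close>

lemma triangulation_right_nested: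
  assumes "triangulation a b S" and "(x0, x1, x2) \<in> S" and "(y0, x0, y2) \<in> S"
  shows "x2 \<le> y2"
  using assms
proof (induction rule: triangulation.induct)
  case (glue a m L b R)
  note less = triangulation_less[OF glue.hyps(1)] triangulation_less[OF glue.hyps(2)]
    and L = triangulation_range[OF glue.hyps(1)] and R = triangulation_range[OF glue.hyps(2)]
  from glue.prems less show ?case
    by (elim insertE UnE) (blast dest: glue.IH | force dest!: L R)+
qed simp

lemma triangulation_left_leg_not_right_leg:
  assumes S: "triangulation a b S" and x: "(r, p, q) \<in> S"
  shows "(p, q, s) \<notin> S"
proof
  assume y: "(p, q, s) \<in> S"
  show False
    using triangulation_right_nested[OF S y x] triangulation_range[OF S y] by simp
qed

text \<open>If \<open>r < s\<close>, nesting below the left leg \<open>(p, s)\<close> would force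
  \<open>q \<le> s\<close>, against \<open>s < q\<close>.\<close>

lemma triangulation_long_leg_unique:
  assumes S: "triangulation a b S" and x: "(p, r, q) \<in> S" and y: "(p, s, q) \<in> S"
  shows "r = s"
  using triangulation_left_nested[OF S x y] triangulation_left_nested[OF S y x]
    triangulation_range[OF S x] triangulation_range[OF S y]
  by (cases r s rule: linorder_cases) auto

lemma triangulation_empty_iff:
  assumes "triangulation a b S"
  shows "S = {} \<longleftrightarrow> b = Suc a"
  using assms
proof (cases rule: triangulation.cases)
  case (glue m L R)
  then show ?thesis
    using triangulation_less[OF glue(2)] triangulation_less[OF glue(3)] by auto
qed simp

lemma triangulation_root:
  assumes "triangulation a b S" and "Suc a < b"
  shows "\<exists>m. (a, m, b) \<in> S"
  using assms by (cases rule: triangulation.cases) auto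

section \<open>Faces, and the identification of 2-cells with triangulations\<close>

lemma neg_faces_iff: "(p, q) \<in> neg_faces S \<longleftrightarrow> (\<exists>m. (p, m, q) \<in> S)"
  by (force simp: neg_faces_def)

lemma pos_faces_iff: "(p, q) \<in> pos_faces S \<longleftrightarrow> (\<exists>r. (p, q, r) \<in> S) \<or> (\<exists>r. (r, p, q) \<in> S)"
  by (force simp: pos_faces_def)

lemma neg_faces_glue:
  "neg_faces (insert (a, m, b) (L \<union> R)) = insert (a, b) (neg_faces L \<union> neg_faces R)"
  by (auto simp: neg_faces_def)

lemma pos_faces_glue:
  "pos_faces (insert (a, m, b) (L \<union> R)) = {(a, m), (m, b)} \<union> (pos_faces L \<union> pos_faces R)"
  by (auto simp: pos_faces_def)

lemma unit_edges_split:
  "a \<le> m \<Longrightarrow> m \<le> b \<Longrightarrow> unit_edges a b = unit_edges a m \<union> unit_edges m b"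
  by (force simp: unit_edges_def)

text \<open>The boundary equations, in a form that is also valid for the empty triangulation.\<close>

lemma triangulation_faces:
  assumes "triangulation a b S"
  shows "insert (a, b) (pos_faces S) = neg_faces S \<union> unit_edges a b"
  using assms
proof (induction rule: triangulation.induct)
  case (edge a)
  then show ?case by (auto simp: neg_faces_def pos_faces_def unit_edges_def)
next
  case (glue a m L b R)
  have "unit_edges a b = unit_edges a m \<union> unit_edges m b"
    using triangulation_less[OF glue.hyps(1)] triangulation_less[OF glue.hyps(2)]
    by (intro unit_edges_split) auto
  then show ?case
    using glue.IH unfolding neg_faces_glue pos_faces_glue by auto
qed

lemma triangulation_base_not_pos_face:
  assumes "triangulation a b S"
  shows "(a, b) \<notin> pos_faces S"
  using triangulation_range[OF assms] by (fastforce simp: pos_faces_iff)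

lemma triangulation_unit_not_neg_face:
  assumes "triangulation a b S" and "(p, q) \<in> unit_edges a b"
  shows "(p, q) \<notin> neg_faces S"
  using triangulation_range[OF assms(1)] assms(2) by (fastforce simp: unit_edges_def neg_faces_iff)

lemma two_cell_if_triangulation:
  assumes S: "triangulation 0 n S"
  shows "two_cell n S"
proof (cases "n = 1")
  case True
  then show ?thesis using triangulation_empty_iff[OF S] by (simp add: two_cell_def)
next
  case False
  then have n: "n \<ge> 2" using triangulation_less[OF S] by simp
  have "S \<subseteq> triangles n"
    using triangulation_range[OF S] by (auto simp: triangles_def)
  moreover have "inj_on left_leg S" "inj_on right_leg S" "inj_on long_leg S"
    by (auto intro!: inj_onI dest: triangulation_middle_unique[OF S]
      triangulation_long_leg_unique[OF S])
  moreover have "\<forall>(x0, x1, x2)\<in>S. \<forall>(y0, y1, y2)\<in>S. x1 = y0 \<longrightarrow> x2 \<noteq> y1"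
    using triangulation_left_leg_not_right_leg[OF S] by blast
  moreover have "neg_faces S - pos_faces S = {(0, n)} \<and> pos_faces S - neg_faces S = unit_edges 0 n"
  proof -
    have "(0, n) \<in> neg_faces S"
      using triangulation_root[OF S] n by (simp add: neg_faces_iff)
    \<comment> \<open>\<open>triangulation_faces\<close> equates two unions. Since
      \<open>(0, n)\<close> is no positive face and unit edges are no negative faces, it splits into
      the two set differences.\<close>
    then have "((p, q) \<in> neg_faces S \<and> (p, q) \<notin> pos_faces S \<longleftrightarrow> (p, q) = (0, n)) \<and>
        ((p, q) \<in> pos_faces S \<and> (p, q) \<notin> neg_faces S \<longleftrightarrow> (p, q) \<in> unit_edges 0 n)" for p q
      using eqset_imp_iff[OF triangulation_faces[OF S], of "(p, q)"]
        triangulation_base_not_pos_face[OF S] triangulation_unit_not_neg_face[OF S, of p q]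
      by (cases "(p, q) = (0, n)") auto
    then show ?thesis by (simp add: set_eq_iff)
  qed
  ultimately show ?thesis
    using n by (simp add: two_cell_def unit_edges_def)
qed

text \<open>Unfolds a tree from the edge \<open>(a, b)\<close> downwards: by \<open>long\<close>,
  each leg that is not a unit edge is the long leg of a further triangle, and legs are shorter than
  the long leg.\<close>

lemma triangulation_below_face:
  assumes long: "\<And>p q. (p, q) \<in> pos_faces S \<Longrightarrow> q \<noteq> Suc p \<Longrightarrow> (p, q) \<in> neg_faces S"
    and range: "\<And>p q r. (p, q, r) \<in> S \<Longrightarrow> p < q \<and> q < r"
    and "b = Suc a \<or> (a, b) \<in> neg_faces S"
  shows "\<exists>X\<subseteq>S. triangulation a b X"
  using assms(3)
proof (induction "b - a" arbitrary: a b rule: less_induct)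
  case less
  show ?case
  proof (cases "b = Suc a")
    case True
    then show ?thesis using triangulation.edge by blast
  next
    case False
    with less.prems obtain m where m: "(a, m, b) \<in> S" by (auto simp: neg_faces_iff)
    then have "a < m" "m < b" using range by blast+
    moreover have "(a, m) \<in> pos_faces S" "(m, b) \<in> pos_faces S"
      using m by (auto simp: pos_faces_iff)
    then have "m = Suc a \<or> (a, m) \<in> neg_faces S" "b = Suc m \<or> (m, b) \<in> neg_faces S"
      using long by blast+
    ultimately have "\<exists>L\<subseteq>S. triangulation a m L" "\<exists>R\<subseteq>S. triangulation m b R"
      using less.hyps[of m a] less.hyps[of b m] by simp_all
    then obtain L R where "L \<subseteq> S" "triangulation a m L" "R \<subseteq> S" "triangulation m b R"
      by blast
    with m show ?thesis
      by (intro exI[of _ "insert (a, m, b) (L \<union> R)"]) (simp add: triangulation.glue)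
  qed
qed

lemma triangulation_if_two_cell:
  assumes S: "two_cell n S"
  shows "triangulation 0 n S"
proof (cases "n = 1")
  case True
  then show ?thesis using S triangulation.edge[of 0] by (simp add: two_cell_def)
next
  case False
  then have n: "n \<ge> 2" and sub: "S \<subseteq> triangles n" and inj: "inj_on long_leg S"
    and neg: "neg_faces S - pos_faces S = {(0, n)}"
    and pos: "pos_faces S - neg_faces S = {(i, i + 1) | i. i < n}"
    using S by (auto simp: two_cell_def)
  have range: "p < q \<and> q < r \<and> r \<le> n" if "(p, q, r) \<in> S" for p q r
    using sub that by (auto simp: triangles_def)
  have inj': "r = r'" if "(p, r, q) \<in> S" "(p, r', q) \<in> S" for p q r r'
    using inj_onD[OF inj, of "(p, r, q)" "(p, r', q)"] that by simp
  have "\<exists>X\<subseteq>S. triangulation 0 n X"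
  proof (rule triangulation_below_face)
    show "(p, q) \<in> neg_faces S" if "(p, q) \<in> pos_faces S" "q \<noteq> Suc p" for p q
      using eqset_imp_iff[OF pos, of "(p, q)"] that by simp
    show "p < q \<and> q < r" if "(p, q, r) \<in> S" for p q r using range that by blast
    show "n = Suc 0 \<or> (0, n) \<in> neg_faces S"
      using eqset_imp_iff[OF neg, of "(0, n)"] by simp
  qed
  then obtain X where X: "X \<subseteq> S" "triangulation 0 n X" by blast
  text \<open>By downward induction on the length of its long leg, every triangle of \<open>S\<close> is in \<open>X\<close>: its
    long leg is \<open>(0, n)\<close> or a leg of a longer triangle.\<close>
  have "(p, q, r) \<in> X" if "(p, q, r) \<in> S" for p q r
    using that
  proof (induction "n - (r - p)" arbitrary: p q r rule: less_induct)
    case less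
    note x = range[OF less.prems]
    have "(p, r) \<in> insert (0, n) (pos_faces X)"
    proof (cases "(p, r) \<in> pos_faces S")
      case True
      then consider s where "(p, r, s) \<in> S" | s where "(s, p, r) \<in> S"
        by (auto simp: pos_faces_iff)
      then show ?thesis
      proof cases
        case 1
        have "n - (s - p) < n - (r - p)" using x range[OF 1] by arith
        then have "(p, r, s) \<in> X" using 1 by (rule less.hyps)
        then show ?thesis by (auto simp: pos_faces_iff)
      next
        case 2
        have "n - (r - s) < n - (r - p)" using x range[OF 2] by arith
        then have "(s, p, r) \<in> X" using 2 by (rule less.hyps)
        then show ?thesis by (auto simp: pos_faces_iff)
      qed
    next
      case False
      moreover have "(p, r) \<in> neg_faces S" using less.prems by (auto simp: neg_faces_iff)
      ultimately show ?thesis using eqset_imp_iff[OF neg, of "(p, r)"] by simp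
    qed
    \<comment> \<open>Since \<open>p < q < r\<close>, the edge \<open>(p, r)\<close> is not a unit
      edge, so it has to be a long leg in \<open>X\<close>; injectivity of \<open>long_leg\<close>
      on \<open>S\<close> then identifies the triangle.\<close>
    then have "(p, r) \<in> neg_faces X"
      using x triangulation_faces[OF X(2)] by (auto simp: unit_edges_def)
    then obtain q' where "(p, q', r) \<in> X" by (auto simp: neg_faces_iff)
    with inj'[OF less.prems] X(1) show ?case by blast
  qed
  with X have "S = X" by auto
  with X show ?thesis by simp
qed

section \<open>Comparison of outer vertices\<close>

text \<open>If \<open>y0 < x0\<close>, the triangles with middle vertex \<open>x0\<close> give a
  contradiction: the one in \<open>S\<close> ends at \<open>x2\<close> or later, hence beyond
  \<open>i\<close>, while the one in \<open>T\<close> lies below the left leg \<open>(y0, i)\<close>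
  and ends by \<open>i\<close>.\<close>

lemma first_le_if_last_le:
  assumes S: "triangulation a b S" and T: "triangulation a b T"
    and le: "\<And>i x0 x2 y0 y2. (x0, i, x2) \<in> S \<Longrightarrow> (y0, i, y2) \<in> T \<Longrightarrow> x2 \<le> y2"
    and x: "(x0, i, x2) \<in> S" and y: "(y0, i, y2) \<in> T"
  shows "x0 \<le> y0"
proof (rule ccontr)
  assume "\<not> x0 \<le> y0"
  moreover note triangulation_range[OF S x] triangulation_range[OF T y]
  ultimately have x0: "a < x0" "x0 < b" "y0 < x0" "x0 < i" "i < x2" by auto
  obtain p q where pq: "(p, x0, q) \<in> S" using triangulation_middle_exists[OF S x0(1,2)] by blast
  obtain p' q' where pq': "(p', x0, q') \<in> T"
    using triangulation_middle_exists[OF T x0(1,2)] by blast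
  have "x2 \<le> q" by (rule triangulation_right_nested[OF S x pq])
  also have "q \<le> q'" by (rule le[OF pq pq'])
  also have "q' \<le> i" by (rule triangulation_left_nested[OF T y pq' x0(3,4)])
  finally show False using x0 by simp
qed

text \<open>Only two middle vertices are affected: at \<open>z1\<close> the last vertex rises from
  \<open>z2\<close> to \<open>z3\<close>, and at \<open>z2\<close> the first vertex rises from
  \<open>z0\<close> to \<open>z1\<close>.\<close>

lemma rotation_le:
  assumes "rotation a b S T" and x: "(x0, i, x2) \<in> S" and y: "(y0, i, y2) \<in> T"
  shows "x0 \<le> y0 \<and> x2 \<le> y2"
proof -
  from assms(1) obtain z0 z1 z2 z3 where S: "triangulation a b S"
    and z: "(z0, z1, z2) \<in> S" "(z0, z2, z3) \<in> S"
    and T: "T = (S - {(z0, z1, z2), (z0, z2, z3)}) \<union> {(z0, z1, z3), (z1, z2, z3)}"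
    by (auto simp: rotation_def)
  have "z0 < z1" "z1 < z2" "z2 < z3"
    using triangulation_range[OF S z(1)] triangulation_range[OF S z(2)] by auto
  with y T z show ?thesis
    using triangulation_middle_unique[OF S x] by fastforce
qed

lemma rotations_le:
  assumes "(rotation a b)\<^sup>*\<^sup>* S T" and "triangulation a b S"
    and "(x0, i, x2) \<in> S" and "(y0, i, y2) \<in> T"
  shows "x0 \<le> y0 \<and> x2 \<le> y2"
  using assms
proof (induction arbitrary: y0 y2 rule: rtranclp_induct)
  case base
  then show ?case using triangulation_middle_unique by fastforce
next
  case (step T U)
  have T: "triangulation a b T" using step.hyps(2) by (simp add: rotation_def)
  \<comment> \<open>Transitivity needs a triangle at \<open>i\<close> in the intermediate
    triangulation.\<close>
  have "a < i" "i < b" using triangulation_range[OF step.prems(1,2)] by auto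
  then obtain z0 z2 where z: "(z0, i, z2) \<in> T" using triangulation_middle_exists[OF T] by blast
  then show ?case
    using step.IH[OF step.prems(1,2) z] rotation_le[OF step.hyps(2) z step.prems(3)] by simp
qed

section \<open>Construction of sequences of rotations\<close>

text \<open>By their ranges, the two removed triangles are neither the root nor in \<open>R\<close>,
  so the set difference affects \<open>L\<close> alone.\<close>

lemma rotation_glue_left:
  assumes "rotation a m L L'" and R: "triangulation m b R"
  shows "rotation a b (insert (a, m, b) (L \<union> R)) (insert (a, m, b) (L' \<union> R))"
proof -
  from assms(1) obtain z0 z1 z2 z3
    where L: "triangulation a m L" and L': "triangulation a m L'"
    and z: "(z0, z1, z2) \<in> L" "(z0, z2, z3) \<in> L"
    and eq: "L' = (L - {(z0, z1, z2), (z0, z2, z3)}) \<union> {(z0, z1, z3), (z1, z2, z3)}"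
    by (auto simp: rotation_def)
  let ?Z = "insert (a, m, b) R"
  have "{(z0, z1, z2), (z0, z2, z3)} \<inter> ?Z = {}"
    using triangulation_range[OF L z(1)] triangulation_range[OF L z(2)] triangulation_range[OF R]
    by fastforce
  then have "insert (a, m, b) (L' \<union> R) = (insert (a, m, b) (L \<union> R) - {(z0, z1, z2), (z0, z2, z3)})
      \<union> {(z0, z1, z3), (z1, z2, z3)}"
    unfolding eq by blast
  then show ?thesis
    using z triangulation.glue[OF L R] triangulation.glue[OF L' R] unfolding rotation_def by blast
qed

lemma rotation_glue_right:
  assumes "rotation m b R R'" and L: "triangulation a m L"
  shows "rotation a b (insert (a, m, b) (L \<union> R)) (insert (a, m, b) (L \<union> R'))"
proof -
  from assms(1) obtain z0 z1 z2 z3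
    where R: "triangulation m b R" and R': "triangulation m b R'"
    and z: "(z0, z1, z2) \<in> R" "(z0, z2, z3) \<in> R"
    and eq: "R' = (R - {(z0, z1, z2), (z0, z2, z3)}) \<union> {(z0, z1, z3), (z1, z2, z3)}"
    by (auto simp: rotation_def)
  let ?Z = "insert (a, m, b) L"
  have "{(z0, z1, z2), (z0, z2, z3)} \<inter> ?Z = {}"
    using triangulation_range[OF R z(1)] triangulation_range[OF R z(2)] triangulation_range[OF L]
    by fastforce
  then have "insert (a, m, b) (L \<union> R') = (insert (a, m, b) (L \<union> R) - {(z0, z1, z2), (z0, z2, z3)})
      \<union> {(z0, z1, z3), (z1, z2, z3)}"
    unfolding eq by blast
  then show ?thesis
    using z triangulation.glue[OF L R] triangulation.glue[OF L R'] unfolding rotation_def by blast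
qed

lemma rotations_glue:
  assumes "(rotation a m)\<^sup>*\<^sup>* L L'" and "(rotation m b)\<^sup>*\<^sup>* R R'"
    and L: "triangulation a m L" and R: "triangulation m b R"
  shows "(rotation a b)\<^sup>*\<^sup>* (insert (a, m, b) (L \<union> R)) (insert (a, m, b) (L' \<union> R'))"
proof -
  \<comment> \<open>The left subtree is rotated first. The first conjunct is carried along because
    \<open>rotation_glue_right\<close> requires it of the resulting left subtree.\<close>
  have "triangulation a m L' \<and>
      (rotation a b)\<^sup>*\<^sup>* (insert (a, m, b) (L \<union> R)) (insert (a, m, b) (L' \<union> R))"
    using assms(1)
  proof (induction rule: rtranclp_induct)
    case (step L' L'')
    have "triangulation a m L''" using step.hyps(2) unfolding rotation_def by blast
    with rtranclp.rtrancl_into_rtrancl[OF conjunct2[OF step.IH] rotation_glue_left[OF step.hyps(2) R]]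
    show ?case by blast
  qed (simp add: L)
  then have L': "triangulation a m L'"
    and left: "(rotation a b)\<^sup>*\<^sup>* (insert (a, m, b) (L \<union> R)) (insert (a, m, b) (L' \<union> R))"
    by auto
  have "(rotation a b)\<^sup>*\<^sup>* (insert (a, m, b) (L' \<union> R)) (insert (a, m, b) (L' \<union> R'))"
    using assms(2)
  proof (induction rule: rtranclp_induct)
    case (step R' R'')
    show ?case
      by (rule rtranclp.rtrancl_into_rtrancl[OF step.IH rotation_glue_right[OF step.hyps(2) L']])
  qed simp
  with left show ?thesis by (rule rtranclp_trans)
qed

text \<open>The associativity move from \<open>(A B) C\<close> to \<open>A (B C)\<close>.\<close>

lemma rotation_root:
  assumes "triangulation a m A" and "triangulation m k B" and "triangulation k b C"
  shows "rotation a b (insert (a, k, b) (insert (a, m, k) (A \<union> B) \<union> C))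
    (insert (a, m, b) (A \<union> insert (m, k, b) (B \<union> C)))"
proof -
  let ?S = "insert (a, k, b) (insert (a, m, k) (A \<union> B) \<union> C)"
  let ?T = "insert (a, m, b) (A \<union> insert (m, k, b) (B \<union> C))"
  have "{(a, m, k), (a, k, b)} \<inter> (A \<union> B \<union> C) = {}"
    using triangulation_range[OF assms(1)] triangulation_range[OF assms(2)]
      triangulation_range[OF assms(3)] triangulation_less[OF assms(1)]
      triangulation_less[OF assms(2)] triangulation_less[OF assms(3)] by fastforce
  then have "?T = (?S - {(a, m, k), (a, k, b)}) \<union> {(a, m, b), (m, k, b)}"
    by blast
  moreover have "triangulation a b ?S" "triangulation a b ?T"
    using assms by (blast intro: triangulation.glue)+
  ultimately show ?thesis
    unfolding rotation_def by blast
qed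

text \<open>The triangle climbs to the top of the left subtree, and one root rotation finishes. The
  last two conjuncts record how first vertices change, which is what preserves their comparison with
  a target.\<close>

lemma rotate_spine_to_root:
  assumes "triangulation a b S" and "(a, m, c) \<in> S"
  shows "\<exists>L R. triangulation a m L \<and> triangulation m b R \<and>
    (rotation a b)\<^sup>*\<^sup>* S (insert (a, m, b) (L \<union> R)) \<and>
    L \<subseteq> S \<and> (\<forall>(x0, x1, x2)\<in>R. (x0, x1, x2) \<in> S \<or> x0 = m)"
  using assms
proof (induction rule: triangulation.induct)
  case (glue a k SL b SR)
  show ?case
  proof (cases "m = k")
    case True
    with glue.hyps show ?thesis by blast
  next
    case False
    \<comment> \<open>Triangles of \<open>SR\<close> start at \<open>k > a\<close> or later.\<close>
    with glue.prems have "(a, m, c) \<in> SL"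
      using triangulation_range[OF glue.hyps(2)] triangulation_less[OF glue.hyps(1)] by fastforce
    then obtain L R where L: "triangulation a m L" and R: "triangulation m k R"
      and rot: "(rotation a k)\<^sup>*\<^sup>* SL (insert (a, m, k) (L \<union> R))"
      and "L \<subseteq> SL" "\<forall>(x0, x1, x2)\<in>R. (x0, x1, x2) \<in> SL \<or> x0 = m"
      using glue.IH(1) by blast
    moreover have "(rotation a b)\<^sup>*\<^sup>* (insert (a, k, b) (SL \<union> SR))
        (insert (a, m, b) (L \<union> insert (m, k, b) (R \<union> SR)))"
      using rotations_glue[OF rot rtranclp.rtrancl_refl glue.hyps] rotation_root[OF L R glue.hyps(2)]
      by (rule rtranclp.rtrancl_into_rtrancl)
    moreover have "triangulation m b (insert (m, k, b) (R \<union> SR))"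
      using R glue.hyps(2) by (rule triangulation.glue)
    ultimately show ?thesis
      by (intro exI[of _ L] exI[of _ "insert (m, k, b) (R \<union> SR)"]) auto
  qed
qed simp

text \<open>Induction on the target, with \<open>S\<close> arbitrary because the subtrees to be
  compared arise only after the root of the target has been rotated into place.\<close>

lemma rotations_if_first_le:
  assumes "triangulation a b T" and "triangulation a b S"
    and "\<And>i x0 x2 y0 y2. (x0, i, x2) \<in> S \<Longrightarrow> (y0, i, y2) \<in> T \<Longrightarrow> x0 \<le> y0"
  shows "(rotation a b)\<^sup>*\<^sup>* S T"
  using assms
proof (induction arbitrary: S rule: triangulation.induct)
  case (edge a)
  then show ?case using triangulation_empty_iff[OF edge.prems(1)] by simp
next
  case (glue a m TL b TR)
  have "a < m" "m < b" using glue.hyps triangulation_less by auto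
  then obtain x0 c where x: "(x0, m, c) \<in> S"
    using triangulation_middle_exists[OF glue.prems(1)] by blast
  \<comment> \<open>The target has root \<open>(a, m, b)\<close>, so the comparison at
    \<open>m\<close> gives \<open>x0 \<le> a\<close>.\<close>
  moreover have "x0 = a"
    using glue.prems(2)[OF x, of a b] triangulation_range[OF glue.prems(1) x] by simp
  ultimately have "(a, m, c) \<in> S" by simp
  then obtain L R where L: "triangulation a m L" and R: "triangulation m b R"
    and rot: "(rotation a b)\<^sup>*\<^sup>* S (insert (a, m, b) (L \<union> R))"
    and LS: "L \<subseteq> S" and RS: "\<forall>(x0, x1, x2)\<in>R. (x0, x1, x2) \<in> S \<or> x0 = m"
    using rotate_spine_to_root[OF glue.prems(1)] by blast
  have "(rotation a m)\<^sup>*\<^sup>* L TL"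
    using glue.prems(2) LS by (intro glue.IH(1)[OF L]) blast
  moreover have "(rotation m b)\<^sup>*\<^sup>* R TR"
  proof (rule glue.IH(2)[OF R])
    fix i x0 x2 y0 y2 assume "(x0, i, x2) \<in> R" and y: "(y0, i, y2) \<in> TR"
    then consider "(x0, i, x2) \<in> S" | "x0 = m" using RS by blast
    then show "x0 \<le> y0"
    proof cases
      case 1
      then show ?thesis using glue.prems(2) y by blast
    next
      \<comment> \<open>A triangle created by the rotations starts at \<open>m\<close>, and no
        triangle of \<open>TR\<close> starts earlier.\<close>
      case 2
      then show ?thesis using triangulation_range[OF glue.hyps(2) y] by simp
    qed
  qed
  ultimately have "(rotation a b)\<^sup>*\<^sup>* (insert (a, m, b) (L \<union> R)) (insert (a, m, b) (TL \<union> TR))"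
    using L R by (rule rotations_glue)
  with rot show ?case by (rule rtranclp_trans)
qed

section \<open>Translation back to cells and to the functions \<open>ell\<close> and
  \<open>arr\<close>\<close>

lemma two_cell_iff_triangulation: "two_cell n S \<longleftrightarrow> triangulation 0 n S"
  using two_cell_if_triangulation triangulation_if_two_cell by blast

lemma indecomposable_3cell_iff_rotation: "indecomposable_3cell n S T \<longleftrightarrow> rotation 0 n S T"
proof
  assume "rotation 0 n S T"
  then obtain x0 x1 x2 x3 where "triangulation 0 n S" "triangulation 0 n T"
    "(x0, x1, x2) \<in> S" "(x0, x2, x3) \<in> S"
    "T = (S - {(x0, x1, x2), (x0, x2, x3)}) \<union> {(x0, x1, x3), (x1, x2, x3)}"
    by (auto simp: rotation_def)
  moreover from this have "x0 < x1" "x1 < x2" "x2 < x3" "x3 \<le> n"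
    using triangulation_range by blast+
  ultimately show "indecomposable_3cell n S T"
    unfolding indecomposable_3cell_def two_cell_iff_triangulation by blast
qed (auto simp: indecomposable_3cell_def two_cell_iff_triangulation rotation_def)

lemma exists_3cell_iff_rotations: "exists_3cell n S T \<longleftrightarrow> (rotation 0 n)\<^sup>*\<^sup>* S T"
proof -
  have "indecomposable_3cell n = rotation 0 n"
    by (intro ext) (rule indecomposable_3cell_iff_rotation)
  then show ?thesis by (simp add: exists_3cell_def)
qed

lemma triangle_at_eq:
  assumes "triangulation a b S" and "(x0, i, x2) \<in> S"
  shows "triangle_at S i = (x0, i, x2)"
  unfolding triangle_at_def
proof (rule the_equality)
  fix t assume t: "t \<in> S \<and> middle t = i"
  obtain y0 y1 y2 where "t = (y0, y1, y2)" by (rule prod_cases3)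
  with t show "t = (x0, i, x2)"
    using triangulation_middle_unique[OF assms, of y0 y2] by auto
qed (simp add: assms(2))

lemma ell_le_iff:
  assumes S: "triangulation 0 n S" and T: "triangulation 0 n T"
  shows "pointwise_le n (ell n S) (ell n T) \<longleftrightarrow>
    (\<forall>(x0, x1, x2)\<in>S. \<forall>(y0, y1, y2)\<in>T. x1 = y1 \<longrightarrow> x0 \<le> y0)"
    (is "?le \<longleftrightarrow> ?first")
proof
  assume le: ?le
  have "x0 \<le> y0" if x: "(x0, i, x2) \<in> S" and y: "(y0, i, y2) \<in> T" for i x0 x2 y0 y2
  proof -
    have "0 < i" "i < n" using triangulation_range[OF S x] by auto
    \<comment> \<open>The middle vertex \<open>i\<close> corresponds to the argument
      \<open>i - 1\<close> of \<open>ell\<close>; \<open>i < n\<close> keeps it away from the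
      default value at \<open>n - 1\<close>.\<close>
    then have i: "i - 1 < n" "i - 1 \<noteq> n - 1" "i - 1 + 1 = i" by auto
    have "ell n S (i - 1) \<le> ell n T (i - 1)"
      using le i(1) by (simp add: pointwise_le_def)
    then show ?thesis
      unfolding ell_def i(3) triangle_at_eq[OF S x] triangle_at_eq[OF T y] using i(2) by simp
  qed
  then show ?first by blast
next
  assume first: ?first
  have "ell n S j \<le> ell n T j" if "j < n" for j
  proof (cases "j = n - 1")
    case False
    with that have "0 < j + 1" "j + 1 < n" by auto
    then obtain x0 x2 y0 y2 where xy: "(x0, j + 1, x2) \<in> S" "(y0, j + 1, y2) \<in> T"
      using triangulation_middle_exists[OF S, of "j + 1"]
        triangulation_middle_exists[OF T, of "j + 1"] by auto
    then have "x0 \<le> y0" using first by fastforce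
    then show ?thesis
      unfolding ell_def triangle_at_eq[OF S xy(1)] triangle_at_eq[OF T xy(2)] by simp
  qed (simp add: ell_def)
  then show ?le by (simp add: pointwise_le_def)
qed

lemma arr_le_iff:
  assumes S: "triangulation 0 n S" and T: "triangulation 0 n T"
  shows "pointwise_le n (arr n S) (arr n T) \<longleftrightarrow>
    (\<forall>(x0, x1, x2)\<in>S. \<forall>(y0, y1, y2)\<in>T. x1 = y1 \<longrightarrow> x2 \<le> y2)"
    (is "?le \<longleftrightarrow> ?last")
proof
  assume le: ?le
  have "x2 \<le> y2" if x: "(x0, i, x2) \<in> S" and y: "(y0, i, y2) \<in> T" for i x0 x2 y0 y2
  proof -
    \<comment> \<open>The last vertices are positive, so the truncated subtraction in
      \<open>arr\<close> loses nothing.\<close>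
    have "0 < i" "i < n" "i < x2" "i < y2"
      using triangulation_range[OF S x] triangulation_range[OF T y] by auto
    moreover have "arr n S i \<le> arr n T i"
      using le \<open>i < n\<close> by (simp add: pointwise_le_def)
    ultimately show ?thesis
      by (simp add: arr_def triangle_at_eq[OF S x] triangle_at_eq[OF T y])
  qed
  then show ?last by blast
next
  assume last: ?last
  have "arr n S j \<le> arr n T j" if "j < n" for j
  proof (cases "j = 0")
    case False
    with that obtain x0 x2 y0 y2 where xy: "(x0, j, x2) \<in> S" "(y0, j, y2) \<in> T"
      using triangulation_middle_exists[OF S, of j] triangulation_middle_exists[OF T, of j] by auto
    then have "x2 \<le> y2" using last by fastforce
    then show ?thesis
      using False triangle_at_eq[OF S xy(1)] triangle_at_eq[OF T xy(2)] by (simp add: arr_def)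
  qed (simp add: arr_def)
  then show ?le by (simp add: pointwise_le_def)
qed

theorem proposition6p2:
  fixes n :: nat and S T :: "triangle set"
  assumes "n \<ge> 1" and "two_cell n S" and "two_cell n T"
  shows "let
      i = pointwise_le n (ell n S) (ell n T);
      ii = pointwise_le n (arr n S) (arr n T);
      iii = exists_3cell n S T;
      iv = (\<forall>(x0, x1, x2)\<in>S. \<forall>(y0, y1, y2)\<in>T. x1 = y1 \<longrightarrow> x0 \<le> y0);
      v = (\<forall>(x0, x1, x2)\<in>S. \<forall>(y0, y1, y2)\<in>T. x1 = y1 \<longrightarrow> x2 \<le> y2);
      vi = (\<forall>(x0, x1, x2)\<in>S. \<forall>(y0, y1, y2)\<in>T. x1 = y1 \<longrightarrow> x0 \<le> y0 \<and> x2 \<le> y2)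
    in (i \<longleftrightarrow> ii) \<and> (ii \<longleftrightarrow> iii) \<and> (iii \<longleftrightarrow> iv) \<and> (iv \<longleftrightarrow> v) \<and> (v \<longleftrightarrow> vi)"
proof -
  have S: "triangulation 0 n S" and T: "triangulation 0 n T"
    using assms by (simp_all add: two_cell_iff_triangulation)
  let ?iv = "\<forall>(x0, x1, x2)\<in>S. \<forall>(y0, y1, y2)\<in>T. x1 = y1 \<longrightarrow> x0 \<le> y0"
  let ?v = "\<forall>(x0, x1, x2)\<in>S. \<forall>(y0, y1, y2)\<in>T. x1 = y1 \<longrightarrow> x2 \<le> y2"
  let ?vi = "\<forall>(x0, x1, x2)\<in>S. \<forall>(y0, y1, y2)\<in>T. x1 = y1 \<longrightarrow> x0 \<le> y0 \<and> x2 \<le> y2"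
  \<comment> \<open>The cycle is (iv), (iii), (vi), (v) and back to (iv); \<open>ell_le_iff\<close>
    and \<open>arr_le_iff\<close> attach (i) to (iv) and (ii) to (v).\<close>
  have iv_iii: "exists_3cell n S T" if ?iv
    unfolding exists_3cell_iff_rotations
    by (rule rotations_if_first_le[OF T S]) (use that in blast)
  have iii_vi: ?vi if "exists_3cell n S T"
    using rotations_le[OF that[unfolded exists_3cell_iff_rotations] S] by blast
  have v_iv: ?iv if v: ?v
  proof -
    have "x0 \<le> y0" if "(x0, i, x2) \<in> S" "(y0, i, y2) \<in> T" for i x0 x2 y0 y2
      by (rule first_le_if_last_le[OF S T _ that]) (use v in blast)
    then show ?thesis by blast
  qed
  have vi_iv: ?iv if ?vi using that by blast
  have vi_v: ?v if ?vi using that by blast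
  show ?thesis
    unfolding Let_def ell_le_iff[OF S T] arr_le_iff[OF S T]
    using iv_iii iii_vi v_iv vi_iv vi_v by argo
qed

end
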